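(* Let $m,n,d,e$ be positive integers with $m=2n$ and $e=\gcd(n,d)=\gcd(m,d)$, and let $s\ge v\ge1$ be integers. Then \[\sum_{i=0}^v(-1)^{v-i}4^{e\binom{v-i}{2}}\binom{v}{i}_{4^e}2^{-mi}|V_{s,i}|=2^{(e-m)v}\prod_{j=0}^{v-1}(2^{m}-4^{ej}),\] where $|V_{s,0}|=1$.
   Context: For integers $s\ge0$ and $i\ge1$, $V_{s,i}$ denotes the set of solutions $(x_1,\dots,x_{2i})\in\mathbb{F}_{2^m}^{2i}$ of the system \[\sum_{l=1}^i\big(x_{2l-1}x_{2l}^{2^{(\frac{n}{e}-j)d}}+x_{2l-1}^{2^{(\frac{n}{e}-j)d}}x_{2l}\big)=0,\qquad j=0,1,\dots,s.\] $\binom{a}{b}_q$ is the Gaussian binomial coefficient and $\binom{a}{2}=a(a-1)/2$. *)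

theory Defs
  imports Complex_Main
begin

definition gauss_binom :: "real \<Rightarrow> nat \<Rightarrow> nat \<Rightarrow> real" where
  "gauss_binom q a b =
     (if b \<le> a then (\<Prod>k<b. (q ^ (a - k) - 1) / (q ^ (k + 1) - 1)) else 0)"

text \<open>Exponent t with x^(2^t) = x^(2^((n/e - j) d)) on GF(2^m); the possibly negative
  integer (n/e - j) d is reduced modulo m (Frobenius has order m on GF(2^m)).\<close>
definition frob_exp :: "nat \<Rightarrow> nat \<Rightarrow> nat \<Rightarrow> nat \<Rightarrow> nat \<Rightarrow> nat" where
  "frob_exp m n d e j = nat (((int (n div e) - int j) * int d) mod int m)"

text \<open>V_{s,i}: tuples (x_1,...,x_{2i}) (as lists, x_k = xs!(k-1)) solving the system.\<close>
definition V_set :: "nat \<Rightarrow> nat \<Rightarrow> nat \<Rightarrow> nat \<Rightarrow> nat \<Rightarrow> nat \<Rightarrow> 'a::field list set" where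
  "V_set m n d e s i = {xs. length xs = 2 * i \<and>
     (\<forall>j \<le> s. (\<Sum>l<i. xs ! (2*l) * (xs ! (2*l+1)) ^ (2 ^ frob_exp m n d e j)
                      + (xs ! (2*l)) ^ (2 ^ frob_exp m n d e j) * xs ! (2*l+1)) = 0)}"

end

theory Submission
  imports Defs "HOL-Computational_Algebra.Polynomial" "HOL-Computational_Algebra.Primes"
begin

text \<open>Let \<open>\<sigma>\<close> be the map \<open>x \<mapsto> x ^ (2 ^ d)\<close>, with fixed field \<open>K\<close> of \<open>q = 2 ^ e\<close> elements, and write a
  solution as a pair of lists \<open>xs\<close>, \<open>ys\<close> of length \<open>i\<close>. The equations, together with their images under
  Frobenius powers, say that \<open>x\<^sub>1 \<and> y\<^sub>1 + \<dots> + x\<^sub>i \<and> y\<^sub>i\<close> is killed by \<open>x \<and> y \<mapsto> x \<sigma>\<^sup>k(y) - \<sigma>\<^sup>k(x) y\<close> for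
  \<open>2s + 1\<close> consecutive \<open>k\<close>. Every \<open>K\<close>-linear map agrees on \<open>N\<close> points with a combination of \<open>N\<close>
  consecutive powers of \<open>\<sigma>\<close>, so for \<open>i \<le> s\<close> the bivector itself vanishes over \<open>K\<close>. Adding one \<open>x\<close> to
  \<open>xs\<close> then multiplies the number of admissible \<open>ys\<close> by the size of the field if \<open>x\<close> is in the
  \<open>K\<close>-span of \<open>xs\<close>, and by the size of the new span otherwise. Summing over \<open>xs\<close> gives a recursion
  for the normalised solution counts in \<open>i\<close> and the dimension of the field over \<open>K\<close>. A second
  recursion follows from it, and the two combine to reduce the alternating sum for \<open>v + 1\<close> in
  dimension \<open>D + 2\<close> to the one for \<open>v\<close> in dimension \<open>D\<close>.\<close>

section \<open>Linear maps over the fixed field of an endomorphism\<close>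

locale field_endo =
  fixes \<sigma> :: "'a::field \<Rightarrow> 'a"
  assumes endo_add: "\<sigma> (x + y) = \<sigma> x + \<sigma> y"
    and endo_mult: "\<sigma> (x * y) = \<sigma> x * \<sigma> y"
    and endo_one: "\<sigma> 1 = 1"
begin

definition K :: "'a set" where "K = {a. \<sigma> a = a}"

definition klinear :: "('a \<Rightarrow> 'a) \<Rightarrow> bool" where
  "klinear f \<longleftrightarrow> (\<forall>x y. f (x + y) = f x + f y) \<and> (\<forall>a\<in>K. \<forall>x. f (a * x) = a * f x)"

definition ksubspace :: "'a set \<Rightarrow> bool" where
  "ksubspace H \<longleftrightarrow> 0 \<in> H \<and> (\<forall>x\<in>H. \<forall>y\<in>H. x + y \<in> H) \<and> (\<forall>a\<in>K. \<forall>x\<in>H. a * x \<in> H)"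

fun kspan :: "'a list \<Rightarrow> 'a set" where
  "kspan [] = {0}"
| "kspan (x # xs) = {a * x + u | a u. a \<in> K \<and> u \<in> kspan xs}"

lemma kspan_ConsI: "a \<in> K \<Longrightarrow> u \<in> kspan xs \<Longrightarrow> y = a * x + u \<Longrightarrow> y \<in> kspan (x # xs)"
  by auto

lemma ksubspaceD:
  assumes "ksubspace H"
  shows "0 \<in> H" "x \<in> H \<Longrightarrow> y \<in> H \<Longrightarrow> x + y \<in> H" "a \<in> K \<Longrightarrow> x \<in> H \<Longrightarrow> a * x \<in> H"
  using assms by (auto simp: ksubspace_def)

lemma endo_zero: "\<sigma> 0 = 0"
  using endo_add[of 0 0] by (simp only: add_0_left add_cancel_right_right)

lemma endo_minus: "\<sigma> (- x) = - \<sigma> x"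
  using endo_add[of x "- x"] by (simp add: endo_zero eq_neg_iff_add_eq_0 add.commute)

lemma endo_diff: "\<sigma> (x - y) = \<sigma> x - \<sigma> y"
  using endo_add[of x "- y"] by (simp add: endo_minus)

lemma endo_sum: "\<sigma> (sum f A) = (\<Sum>x\<in>A. \<sigma> (f x))"
  by (induction A rule: infinite_finite_induct) (auto simp: endo_zero endo_add)

lemma endo_eq_0_iff [simp]: "\<sigma> x = 0 \<longleftrightarrow> x = 0"
proof
  assume "\<sigma> x = 0"
  then have "\<sigma> (x * inverse x) = 0"
    by (simp add: endo_mult)
  then show "x = 0"
    using endo_one by (cases "x = 0") auto
qed (simp add: endo_zero)

lemma endo_inverse: "\<sigma> (inverse x) = inverse (\<sigma> x)"
proof (cases "x = 0")
  case False
  then have "\<sigma> x * \<sigma> (inverse x) = 1"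
    by (simp add: endo_one flip: endo_mult)
  then show ?thesis
    by (simp add: inverse_unique)
qed (simp add: endo_zero)

lemma endo_divide: "\<sigma> (x / y) = \<sigma> x / \<sigma> y"
  by (simp add: divide_inverse endo_mult endo_inverse)

lemma K_closed [simp, intro]:
  "0 \<in> K" "1 \<in> K" "a \<in> K \<Longrightarrow> b \<in> K \<Longrightarrow> a + b \<in> K" "a \<in> K \<Longrightarrow> b \<in> K \<Longrightarrow> a - b \<in> K"
  "a \<in> K \<Longrightarrow> b \<in> K \<Longrightarrow> a * b \<in> K" "a \<in> K \<Longrightarrow> - a \<in> K" "a \<in> K \<Longrightarrow> inverse a \<in> K"
  by (auto simp: K_def endo_zero endo_one endo_add endo_diff endo_mult endo_minus endo_inverse)

lemma klinear_zero: "klinear f \<Longrightarrow> f 0 = 0"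
  unfolding klinear_def by (metis K_closed(1) mult_zero_left)

lemma klinear_diff: "klinear f \<Longrightarrow> f (x - y) = f x - f y"
  unfolding klinear_def by (metis add_diff_cancel_right' diff_add_cancel)

lemma klinear_funpow: "klinear (\<sigma> ^^ j)"
proof (induction j)
  case (Suc j)
  then show ?case
    by (auto simp: klinear_def endo_add endo_mult K_def)
qed (auto simp: klinear_def)

lemma funpow_eq_0_iff: "(\<sigma> ^^ j) x = 0 \<longleftrightarrow> x = 0"
  by (induction j) auto

lemma ksubspace_kspan: "ksubspace (kspan xs)"
proof (induction xs)
  case (Cons x xs)
  have "\<exists>a u. 0 = a * x + u \<and> a \<in> K \<and> u \<in> kspan xs"
    using Cons by (intro exI[of _ 0]) (auto simp: ksubspace_def)
  moreover have "\<exists>c w. (a * x + u) + (b * x + v) = c * x + w \<and> c \<in> K \<and> w \<in> kspan xs"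
    if "a \<in> K" "b \<in> K" "u \<in> kspan xs" "v \<in> kspan xs" for a b u v
    using Cons that by (intro exI[of _ "a + b"] exI[of _ "u + v"]) (auto simp: ksubspace_def algebra_simps)
  moreover have "\<exists>c w. b * (a * x + u) = c * x + w \<and> c \<in> K \<and> w \<in> kspan xs"
    if "a \<in> K" "b \<in> K" "u \<in> kspan xs" for a b u
    using Cons that by (intro exI[of _ "b * a"] exI[of _ "b * u"]) (auto simp: ksubspace_def algebra_simps)
  ultimately show ?case
    unfolding ksubspace_def by auto
qed (auto simp: ksubspace_def)

lemma ksubspace_minus: "ksubspace H \<Longrightarrow> x \<in> H \<Longrightarrow> - x \<in> H"
  unfolding ksubspace_def by (metis K_closed(2) K_closed(6) mult_minus1)

lemma ksubspace_diff: "ksubspace H \<Longrightarrow> x \<in> H \<Longrightarrow> y \<in> H \<Longrightarrow> x - y \<in> H"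
  using ksubspace_minus[of H y] unfolding ksubspace_def by (metis add_uminus_conv_diff)

lemma kspan_Cons_mono: "kspan xs \<subseteq> kspan (x # xs)"
proof
  fix u assume "u \<in> kspan xs"
  then show "u \<in> kspan (x # xs)"
    by (intro kspan_ConsI[of 0 u]) auto
qed

lemma set_subset_kspan: "set xs \<subseteq> kspan xs"
proof (induction xs)
  case (Cons x xs)
  have "x \<in> kspan (x # xs)"
    using ksubspace_kspan[of xs] by (intro kspan_ConsI[of 1 0]) (auto simp: ksubspace_def)
  then show ?case
    using Cons kspan_Cons_mono[of xs x] by auto
qed simp

lemma kspan_Cons_absorb:
  assumes "x \<in> kspan xs"
  shows "kspan (x # xs) = kspan xs"
  using kspan_Cons_mono[of xs x] assms ksubspace_kspan[of xs] by (auto simp: ksubspace_def)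

lemma klinear_zero_on_kspan:
  assumes "klinear f" "\<forall>x\<in>set xs. f x = 0" "u \<in> kspan xs"
  shows "f u = 0"
  using assms(2,3)
proof (induction xs arbitrary: u)
  case (Cons x xs)
  then show ?case
    using assms(1) by (auto simp: klinear_def)
qed (use assms(1) klinear_zero in auto)

lemma card_kspan_Cons:
  assumes "x \<notin> kspan xs"
  shows "card (kspan (x # xs)) = card K * card (kspan xs)"
proof -
  have "inj_on (\<lambda>(a, u). a * x + u) (K \<times> kspan xs)"
  proof (rule inj_onI, clarify)
    fix a u b v assume *: "a \<in> K" "u \<in> kspan xs" "b \<in> K" "v \<in> kspan xs" "a * x + u = b * x + v"
    have "a = b"
    proof (rule ccontr)
      assume "a \<noteq> b"
      then have "x = inverse (a - b) * (v - u)"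
        using *(5) by (simp add: field_simps)
      then show False
        using assms * ksubspace_kspan[of xs] ksubspace_diff[OF ksubspace_kspan, of v xs u]
        by (auto simp: ksubspace_def)
    qed
    then show "a = b \<and> u = v" using * by simp
  qed
  moreover have "kspan (x # xs) = (\<lambda>(a, u). a * x + u) ` (K \<times> kspan xs)"
    by auto
  ultimately show ?thesis
    by (simp add: card_image card_cartesian_product)
qed

section \<open>Twisted polynomials in \<open>\<sigma>\<close> and interpolation\<close>

definition skew_ops :: "nat \<Rightarrow> nat \<Rightarrow> ('a \<Rightarrow> 'a) set" where
  "skew_ops c n = range (\<lambda>a x. \<Sum>k<n. a k * (\<sigma> ^^ (c + k)) x)"

lemma skew_opsI: "f = (\<lambda>x. \<Sum>k<n. a k * (\<sigma> ^^ (c + k)) x) \<Longrightarrow> f \<in> skew_ops c n"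
  unfolding skew_ops_def by (rule range_eqI[of _ _ a])

lemma skew_ops_diff_scale:
  assumes "f \<in> skew_ops c n" "g \<in> skew_ops c n"
  shows "(\<lambda>x. f x - b * g x) \<in> skew_ops c n"
proof -
  obtain a a' where "f = (\<lambda>x. \<Sum>k<n. a k * (\<sigma> ^^ (c + k)) x)"
      "g = (\<lambda>x. \<Sum>k<n. a' k * (\<sigma> ^^ (c + k)) x)"
    using assms by (auto simp: skew_ops_def)
  then have "(\<lambda>x. f x - b * g x) = (\<lambda>x. \<Sum>k<n. (a k - b * a' k) * (\<sigma> ^^ (c + k)) x)"
    by (simp add: sum_subtractf sum_distrib_left algebra_simps)
  then show ?thesis by (rule skew_opsI)
qed

lemma skew_ops_Suc:
  assumes "f \<in> skew_ops c n"
  shows "f \<in> skew_ops c (Suc n)"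
proof -
  obtain a where "f = (\<lambda>x. \<Sum>k<n. a k * (\<sigma> ^^ (c + k)) x)"
    using assms by (auto simp: skew_ops_def)
  then have "f = (\<lambda>x. \<Sum>k<Suc n. (if k < n then a k else 0) * (\<sigma> ^^ (c + k)) x)"
    by simp
  then show ?thesis by (rule skew_opsI)
qed

lemma skew_ops_endo:
  assumes "f \<in> skew_ops c n"
  shows "(\<lambda>x. \<sigma> (f x)) \<in> skew_ops c (Suc n)"
proof -
  obtain a where "f = (\<lambda>x. \<Sum>k<n. a k * (\<sigma> ^^ (c + k)) x)"
    using assms by (auto simp: skew_ops_def)
  then have "(\<lambda>x. \<sigma> (f x)) = (\<lambda>x. \<Sum>k<Suc n. (case k of 0 \<Rightarrow> 0 | Suc j \<Rightarrow> \<sigma> (a j)) * (\<sigma> ^^ (c + k)) x)"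
    by (simp add: sum.lessThan_Suc_shift endo_sum endo_mult del: sum.lessThan_Suc)
  then show ?thesis by (rule skew_opsI)
qed

lemma klinear_skew_ops:
  assumes "g \<in> skew_ops c n"
  shows "klinear g"
  using assms klinear_funpow
  by (fastforce simp: klinear_def skew_ops_def sum.distrib sum_distrib_left algebra_simps
      intro!: sum.cong)

text \<open>The twisted analogue of a polynomial with prescribed roots: each new vector costs at
  most one more power of \<open>\<sigma>\<close>, and no zeros outside the span appear.\<close>

lemma ex_skew_op_kernel:
  "\<exists>g\<in>skew_ops c (Suc (length ws)). {x. g x = 0} = kspan ws"
proof (induction ws)
  case Nil
  have "(\<sigma> ^^ c) \<in> skew_ops c (Suc 0)"
    by (rule skew_opsI[where a = "\<lambda>_. 1"]) simp
  then show ?case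
    by (intro bexI[of _ "\<sigma> ^^ c"]) (auto simp: funpow_eq_0_iff)
next
  case (Cons w ws)
  then obtain g where g: "g \<in> skew_ops c (Suc (length ws))" "{x. g x = 0} = kspan ws"
    by blast
  have lin: "klinear g" using g(1) by (rule klinear_skew_ops)
  show ?case
  proof (cases "g w = 0")
    case True
    then show ?thesis
      using g(2) skew_ops_Suc[OF g(1)] kspan_Cons_absorb[of w ws]
      by (intro bexI[of _ g]) (auto simp del: kspan.simps)
  next
    case False
    \<comment> \<open>The left factor \<open>\<sigma> - \<sigma> (g w) / g w\<close> kills
      \<open>g x\<close> exactly when \<open>g x / g w\<close> is fixed by
      \<open>\<sigma>\<close>.\<close>
    define h where "h = (\<lambda>x. \<sigma> (g x) - (\<sigma> (g w) / g w) * g x)"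
    have "h \<in> skew_ops c (Suc (length (w # ws)))"
      unfolding h_def length_Cons by (rule skew_ops_diff_scale[OF skew_ops_endo[OF g(1)] skew_ops_Suc[OF g(1)]])
    moreover have "h x = 0 \<longleftrightarrow> x \<in> kspan (w # ws)" for x
    proof
      assume "h x = 0"
      then have eq: "\<sigma> (g x) = \<sigma> (g w) / g w * g x"
        by (simp add: h_def)
      define b where "b = g x / g w"
      have "b \<in> K"
        unfolding b_def K_def mem_Collect_eq endo_divide eq using False by simp
      moreover from this have "g (x - b * w) = 0"
        using lin False by (simp add: klinear_diff klinear_def) (simp add: b_def)
      ultimately show "x \<in> kspan (w # ws)"
        using g(2) by (intro kspan_ConsI[of b "x - b * w"]) auto
    next
      assume "x \<in> kspan (w # ws)"
      then obtain a u where "x = a * w + u" "a \<in> K" "g u = 0"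
        using g(2) by auto
      then have "g x = a * g w" "\<sigma> a = a"
        using lin by (auto simp: klinear_def K_def)
      then show "h x = 0"
        using False by (simp add: h_def endo_mult)
    qed
    ultimately show ?thesis by blast
  qed
qed

text \<open>Newton interpolation: the next interpolant differs by a multiple of the operator
  annihilating the previous nodes.\<close>
lemma ex_skew_op_interpolating:
  assumes "klinear f"
  shows "\<exists>g\<in>skew_ops c (length ws). \<forall>w\<in>set ws. g w = f w"
proof (induction ws)
  case Nil
  then show ?case by (auto simp: skew_ops_def)
next
  case (Cons w ws)
  then obtain g where g: "g \<in> skew_ops c (length ws)" "\<forall>w\<in>set ws. g w = f w"
    by blast
  obtain z where z: "z \<in> skew_ops c (Suc (length ws))" "{x. z x = 0} = kspan ws"
    using ex_skew_op_kernel by blast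
  define h where "h = (\<lambda>x. g x - ((g w - f w) / z w) * z x)"
  have "h \<in> skew_ops c (length (w # ws))"
    unfolding h_def length_Cons by (rule skew_ops_diff_scale[OF skew_ops_Suc[OF g(1)] z(1)])
  moreover have "h v = f v" if "v \<in> set ws" for v
  proof -
    have "z v = 0" using that z(2) set_subset_kspan[of ws] by blast
    then show ?thesis using g(2) that by (simp add: h_def)
  qed
  moreover have "h w = f w"
  proof (cases "z w = 0")
    \<comment> \<open>Division by \<open>z w = 0\<close> gives 0, so \<open>h = g\<close>. Here
      \<open>w\<close> depends on the earlier nodes, where \<open>g\<close> and \<open>f\<close>
      agree already.\<close>
    case True
    then have "w \<in> kspan ws" using z(2) by blast
    moreover have "klinear (\<lambda>x. g x - f x)"
      using klinear_skew_ops[OF g(1)] assms by (simp add: klinear_def algebra_simps)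
    ultimately have "g w - f w = 0"
      using klinear_zero_on_kspan g(2) by fastforce
    then show ?thesis using True by (simp add: h_def)
  qed (simp add: h_def)
  ultimately show ?case by auto
qed

text \<open>A subspace \<open>H\<close> maximal among those containing \<open>U\<close> and avoiding
  \<open>y\<close> is a complement of the line spanned by \<open>y\<close>; the functional reads off
  the coordinate along that line.\<close>

lemma ex_functional:
  assumes "finite (UNIV :: 'a set)" "ksubspace U" "y \<notin> U"
  shows "\<exists>f. klinear f \<and> range f \<subseteq> K \<and> (\<forall>u\<in>U. f u = 0) \<and> f y = 1"
proof -
  define C where "C = {H. ksubspace H \<and> U \<subseteq> H \<and> y \<notin> H}"
  have "finite C" "U \<in> C"
    using assms by (auto simp: C_def intro: finite_subset[of _ "Pow UNIV"])
  then obtain H where H: "H \<in> C" "U \<subseteq> H" and max: "\<And>H'. H' \<in> C \<Longrightarrow> H \<subseteq> H' \<Longrightarrow> H' = H"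
    using finite_has_maximal2[of C U] by metis
  have sub: "ksubspace H" and yH: "y \<notin> H" using H(1) by (auto simp: C_def)
  have ex: "\<exists>a\<in>K. z - a * y \<in> H" for z
  proof (cases "z \<in> H")
    case True
    then show ?thesis by (intro bexI[of _ 0]) auto
  next
    case False
    define H' where "H' = {a * z + u | a u. a \<in> K \<and> u \<in> H}"
    have "ksubspace H'"
    proof -
      have "\<exists>a u. 0 = a * z + u \<and> a \<in> K \<and> u \<in> H"
        using sub by (intro exI[of _ 0]) (auto simp: ksubspace_def)
      moreover have "\<exists>c w. (a * z + u) + (b * z + v) = c * z + w \<and> c \<in> K \<and> w \<in> H"
        if "a \<in> K" "b \<in> K" "u \<in> H" "v \<in> H" for a b u v
        using sub that by (intro exI[of _ "a + b"] exI[of _ "u + v"]) (auto simp: ksubspace_def algebra_simps)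
      moreover have "\<exists>c w. b * (a * z + u) = c * z + w \<and> c \<in> K \<and> w \<in> H"
        if "a \<in> K" "b \<in> K" "u \<in> H" for a b u
        using sub that by (intro exI[of _ "b * a"] exI[of _ "b * u"]) (auto simp: ksubspace_def algebra_simps)
      ultimately show ?thesis
        unfolding ksubspace_def H'_def by auto
    qed
    moreover have "\<exists>a v. u = a * z + v \<and> a \<in> K \<and> v \<in> H" if "u \<in> H" for u
      using that by (intro exI[of _ 0] exI[of _ u]) auto
    then have "H \<subseteq> H'" by (auto simp: H'_def)
    moreover have "\<exists>a v. z = a * z + v \<and> a \<in> K \<and> v \<in> H"
      using ksubspaceD(1)[OF sub] by (intro exI[of _ 1] exI[of _ 0]) auto
    then have "z \<in> H'" by (auto simp: H'_def)
    ultimately have "y \<in> H'"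
      using max[of H'] False H by (auto simp: C_def)
    then obtain a u where au: "y = a * z + u" "a \<in> K" "u \<in> H"
      by (auto simp: H'_def)
    then have "a \<noteq> 0" using yH by auto
    then have "z - inverse a * y = - (inverse a * u)"
      using au(1) by (simp add: field_simps)
    then show ?thesis
      using au sub ksubspace_minus[OF sub] by (intro bexI[of _ "inverse a"]) (auto simp: ksubspace_def)
  qed
  have uniq: "a = b" if "a \<in> K" "b \<in> K" "z - a * y \<in> H" "z - b * y \<in> H" for a b z
  proof (rule ccontr)
    assume "a \<noteq> b"
    then have "y = inverse (b - a) * ((z - a * y) - (z - b * y))"
      by (simp add: field_simps)
    then show False
      using yH ksubspaceD(3)[OF sub K_closed(7)[OF K_closed(4)[OF that(2,1)]] ksubspace_diff[OF sub that(3,4)]]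
      by simp
  qed
  define f where "f z = (SOME a. a \<in> K \<and> z - a * y \<in> H)" for z
  have f: "f z \<in> K" "z - f z * y \<in> H" for z
    using someI_ex[of "\<lambda>a. a \<in> K \<and> z - a * y \<in> H"] ex[of z] by (auto simp: f_def)
  have f_eq: "f z = a" if "a \<in> K" "z - a * y \<in> H" for z a
    using uniq[OF f(1) that(1) f(2) that(2)] .
  have "f (x + z) = f x + f z" for x z
  proof (rule f_eq)
    have "x + z - (f x + f z) * y = (x - f x * y) + (z - f z * y)"
      by (simp add: algebra_simps)
    then show "x + z - (f x + f z) * y \<in> H"
      by (simp only: ksubspaceD(2)[OF sub f(2) f(2)])
  qed (use f in auto)
  moreover have "f (a * x) = a * f x" if "a \<in> K" for a x
  proof (rule f_eq)
    have "a * x - (a * f x) * y = a * (x - f x * y)"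
      by (simp add: algebra_simps)
    then show "a * x - (a * f x) * y \<in> H"
      by (simp only: ksubspaceD(3)[OF sub that f(2)])
  qed (use f that in auto)
  moreover have "f u = 0" if "u \<in> U" for u
    using that H(2) by (intro f_eq) auto
  moreover have "f y = 1"
    using sub by (intro f_eq) (auto simp: ksubspace_def)
  ultimately show ?thesis
    using f(1) by (intro exI[of _ f]) (auto simp: klinear_def)
qed

end

section \<open>Counting vanishing bivectors\<close>

text \<open>For \<open>K\<close>-linear \<open>\<psi>\<close> the summand is bilinear over
  \<open>K\<close> and alternating, so this is a linear map on bivectors, evaluated at the sum of
  the x \<and> y.\<close>

definition wedge :: "('a \<Rightarrow> 'a) \<Rightarrow> 'a list \<Rightarrow> 'a list \<Rightarrow> 'a::comm_ring" where
  "wedge \<psi> xs ys = (\<Sum>(x, y)\<leftarrow>zip xs ys. x * \<psi> y - \<psi> x * y)"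

lemma wedge_simps [simp]:
  "wedge \<psi> [] ys = 0"
  "wedge \<psi> (x # xs) (y # ys) = x * \<psi> y - \<psi> x * y + wedge \<psi> xs ys"
  by (simp_all add: wedge_def)

lemma wedge_cong:
  assumes "\<forall>x\<in>set xs \<union> set ys. \<phi> x = \<psi> x"
  shows "wedge \<phi> xs ys = wedge \<psi> xs ys"
  unfolding wedge_def
proof (intro arg_cong[of _ _ sum_list] map_cong refl, clarify)
  fix x y assume "(x, y) \<in> set (zip xs ys)"
  then have "\<phi> x = \<psi> x" "\<phi> y = \<psi> y"
    using assms set_zip_leftD set_zip_rightD by fastforce+
  then show "x * \<phi> y - \<phi> x * y = x * \<psi> y - \<psi> x * y" by simp
qed

lemma wedge_linear_combination:
  assumes "length xs = length ys"
  shows "wedge (\<lambda>x. \<Sum>k<n. a k * \<psi> k x) xs ys = (\<Sum>k<n. a k * wedge (\<psi> k) xs ys)"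
  using assms
  by (induction xs ys rule: list_induct2)
    (simp_all add: sum.distrib sum_subtractf sum_distrib_left sum_distrib_right algebra_simps)

lemma wedge_conv_sum:
  assumes "length xs = i" "length ys = i"
  shows "wedge \<psi> xs ys = (\<Sum>l<i. xs ! l * \<psi> (ys ! l) - \<psi> (xs ! l) * ys ! l)"
  using assms by (simp add: wedge_def sum_list_sum_nth atLeast0LessThan)

text \<open>The mean of \<open>|rad B| ^ i\<close> over the alternating forms \<open>B\<close> on a space of dimension \<open>D\<close> over
  a field of \<open>q\<close> elements. For \<open>D = 0\<close> the term with the truncated \<open>D - 1\<close> has coefficient 0.\<close>
fun rad_moment :: "real \<Rightarrow> nat \<Rightarrow> nat \<Rightarrow> real" where
  "rad_moment q D 0 = 1"
| "rad_moment q D (Suc i) =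
    rad_moment q D i + (1 - 1 / q ^ D) * q ^ Suc i * rad_moment q (D - 1) i"

section \<open>Solution sets for fixed first components\<close>

locale finite_field_endo = field_endo \<sigma> for \<sigma> :: "'a::field \<Rightarrow> 'a" +
  assumes finite_UNIV: "finite (UNIV :: 'a set)"
begin

definition sol :: "nat \<Rightarrow> nat \<Rightarrow> 'a list \<Rightarrow> 'a list set" where
  "sol c n xs = {ys. length ys = length xs \<and> (\<forall>k<n. wedge (\<sigma> ^^ (c + k)) xs ys = 0)}"

lemma finite_field_set [simp]: "finite (A :: 'a set)"
  using finite_UNIV by (rule finite_subset[rotated]) simp

lemma finite_lists: "finite {xs :: 'a list. length xs = i}"
  using finite_lists_length_eq[OF finite_UNIV, of i] by simp

text \<open>Applying \<open>\<sigma> ^^ i\<close> to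
  \<open>x * (\<sigma> ^^ j) y - (\<sigma> ^^ j) x * y\<close> undoes the inner power and moves the
  outer one to the other factor, whence the sign.\<close>

lemma wedge_involution:
  assumes "length xs = length ys" "\<And>x. (\<sigma> ^^ i) ((\<sigma> ^^ j) x) = x"
  shows "(\<sigma> ^^ i) (wedge (\<sigma> ^^ j) xs ys) = - wedge (\<sigma> ^^ i) xs ys"
proof -
  have lin: "klinear (\<sigma> ^^ i)" by (rule klinear_funpow)
  have mult: "(\<sigma> ^^ i) (x * y) = (\<sigma> ^^ i) x * (\<sigma> ^^ i) y" for x y
    by (induction i) (simp_all add: endo_mult)
  have add: "(\<sigma> ^^ i) (x + y) = (\<sigma> ^^ i) x + (\<sigma> ^^ i) y" for x y
    using lin by (simp add: klinear_def)
  show ?thesis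
    using assms(1)
    by (induction xs ys rule: list_induct2)
      (simp_all add: klinear_zero[OF lin] klinear_diff[OF lin] add mult assms(2))
qed

text \<open>Only the values of \<open>f\<close> at the entries of \<open>xs\<close> and
  \<open>ys\<close> matter. Their number is at most \<open>n\<close>, so a combination of powers
  from the window interpolates \<open>f\<close> there.\<close>

lemma wedge_klinear_eq_0:
  assumes "ys \<in> sol c n xs" "2 * length xs \<le> n" "klinear f"
  shows "wedge f xs ys = 0"
proof -
  obtain g where g: "g \<in> skew_ops c (length (xs @ ys))" "\<forall>w\<in>set (xs @ ys). g w = f w"
    using ex_skew_op_interpolating[OF assms(3)] by blast
  then obtain a where a: "g = (\<lambda>x. \<Sum>k<length (xs @ ys). a k * (\<sigma> ^^ (c + k)) x)"
    unfolding skew_ops_def by blast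
  have len: "length xs = length ys" using assms(1) by (simp add: sol_def)
  have "wedge f xs ys = wedge g xs ys"
    using g(2) by (intro wedge_cong) auto
  also have "\<dots> = (\<Sum>k<length (xs @ ys). a k * wedge (\<sigma> ^^ (c + k)) xs ys)"
    unfolding a by (rule wedge_linear_combination[OF len])
  also have "\<dots> = 0"
    using assms(1,2) len by (intro sum.neutral) (auto simp: sol_def)
  finally show ?thesis .
qed

lemma wedge_in_kspan:
  assumes "length xs = length ys" "\<forall>x\<in>set xs. f x = 0" "range f \<subseteq> K"
  shows "wedge f xs ys \<in> kspan xs"
  using assms
proof (induction xs ys rule: list_induct2)
  case (Cons x xs y ys)
  then show ?case
    by (intro kspan_ConsI[of "f y" "wedge f xs ys"]) (auto simp: mult.commute)
qed simp

text \<open>Otherwise some functional kills \<open>x\<close> and \<open>xs\<close> and is 1 at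
  \<open>y\<close>; testing the bivector with it writes \<open>x\<close> as a
  \<open>K\<close>-combination of \<open>xs\<close>.\<close>

lemma head_in_kspan:
  assumes "y # ys \<in> sol c n (x # xs)" "2 * Suc (length xs) \<le> n" "x \<notin> kspan xs"
  shows "y \<in> kspan (x # xs)"
proof (rule ccontr)
  assume "y \<notin> kspan (x # xs)"
  then obtain f where f: "klinear f" "range f \<subseteq> K" "\<forall>u\<in>kspan (x # xs). f u = 0" "f y = 1"
    using ex_functional[OF finite_UNIV ksubspace_kspan] by blast
  have zero: "\<forall>z\<in>set (x # xs). f z = 0"
    using f(3) set_subset_kspan by blast
  have "wedge f (x # xs) (y # ys) = 0"
    using wedge_klinear_eq_0[OF assms(1) _ f(1)] assms(2) by simp
  then have "x = - wedge f xs ys"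
    using f(4) zero by (simp add: eq_neg_iff_add_eq_0)
  moreover have "wedge f xs ys \<in> kspan xs"
    using assms(1) zero f(2) by (intro wedge_in_kspan) (auto simp: sol_def)
  ultimately show False
    using assms(3) ksubspace_minus[OF ksubspace_kspan] by blast
qed

text \<open>If \<open>x\<close> lies in the span of \<open>xs\<close>, then the bivector \<open>x \<and> y\<close> is a combination of the
  \<open>x\<^sub>l \<and> y\<close>, hence absorbed by a translation of the second components.\<close>
lemma ex_wedge_kspan:
  assumes "x \<in> kspan xs"
  shows "\<exists>zs. length zs = length xs \<and> (\<forall>j. wedge (\<sigma> ^^ j) xs zs = x * (\<sigma> ^^ j) y - (\<sigma> ^^ j) x * y)"
  using assms
proof (induction xs arbitrary: x)
  case Nil
  then show ?case by (auto simp: funpow_eq_0_iff)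
next
  case (Cons w ws)
  then obtain a u where au: "a \<in> K" "u \<in> kspan ws" "x = a * w + u"
    by auto
  then obtain zs where zs: "length zs = length ws"
      "\<And>j. wedge (\<sigma> ^^ j) ws zs = u * (\<sigma> ^^ j) y - (\<sigma> ^^ j) u * y"
    using Cons.IH by blast
  have "(\<sigma> ^^ j) x = a * (\<sigma> ^^ j) w + (\<sigma> ^^ j) u" "(\<sigma> ^^ j) (a * y) = a * (\<sigma> ^^ j) y" for j
    using au klinear_funpow[of j] by (auto simp: klinear_def)
  then show ?case
    using zs au(3) by (intro exI[of _ "(a * y) # zs"]) (simp add: algebra_simps)
qed

lemma wedge_add:
  assumes "klinear \<psi>" "length xs = length ys" "length ys = length zs"
  shows "wedge \<psi> xs (map2 (+) ys zs) = wedge \<psi> xs ys + wedge \<psi> xs zs"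
  using assms(2,3,1)
  by (induction xs ys zs rule: list_induct3) (simp_all add: klinear_def algebra_simps)

text \<open>Translation by \<open>zs\<close> trades the contribution of the pair (x, y) for a change
  of the tail, so the tails after \<open>y\<close> correspond to the solutions for
  \<open>xs\<close>.\<close>

lemma card_sol_fibre:
  assumes "length zs = length xs"
    and zs: "\<forall>j. wedge (\<sigma> ^^ j) xs zs = x * (\<sigma> ^^ j) y - (\<sigma> ^^ j) x * y"
  shows "card {ys. y # ys \<in> sol c n (x # xs)} = card (sol c n xs)"
proof -
  have add: "wedge (\<sigma> ^^ j) xs (map2 (+) ys zs) = wedge (\<sigma> ^^ j) xs ys + wedge (\<sigma> ^^ j) xs zs"
    if "length ys = length xs" for j ys
    using that assms(1) klinear_funpow by (intro wedge_add) auto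
  have inv: "map2 (+) (map2 (-) ys zs) zs = ys" "map2 (-) (map2 (+) ys zs) zs = ys"
    if "length ys = length xs" for ys
    using that assms(1) by (auto intro: nth_equalityI)
  have "bij_betw (\<lambda>ys. map2 (+) ys zs) {ys. y # ys \<in> sol c n (x # xs)} (sol c n xs)"
  proof (rule bij_betw_byWitness[where f' = "\<lambda>ys. map2 (-) ys zs"])
    show "(\<lambda>ys. map2 (+) ys zs) ` {ys. y # ys \<in> sol c n (x # xs)} \<subseteq> sol c n xs"
    proof clarify
      fix ys assume "y # ys \<in> sol c n (x # xs)"
      then have len: "length ys = length xs"
        and "\<forall>k<n. wedge (\<sigma> ^^ (c + k)) xs zs + wedge (\<sigma> ^^ (c + k)) xs ys = 0"
        using zs by (simp_all add: sol_def)
      then show "map2 (+) ys zs \<in> sol c n xs"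
        using add[OF len] len assms(1) by (simp add: sol_def add.commute)
    qed
    show "(\<lambda>ys. map2 (-) ys zs) ` sol c n xs \<subseteq> {ys. y # ys \<in> sol c n (x # xs)}"
    proof clarify
      fix ys assume ys: "ys \<in> sol c n xs"
      then have len: "length ys = length xs" by (simp add: sol_def)
      have "wedge (\<sigma> ^^ j) xs (map2 (-) ys zs) + wedge (\<sigma> ^^ j) xs zs = wedge (\<sigma> ^^ j) xs ys" for j
        using add[of "map2 (-) ys zs" j] inv(1)[OF len] len assms(1) by simp
      then have "\<forall>k<n. wedge (\<sigma> ^^ (c + k)) xs (map2 (-) ys zs) + wedge (\<sigma> ^^ (c + k)) xs zs = 0"
        using ys by (simp add: sol_def)
      then show "y # map2 (-) ys zs \<in> sol c n (x # xs)"
        using zs len assms(1) by (simp add: sol_def add.commute)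
    qed
  qed (use inv in \<open>auto simp: sol_def\<close>)
  then show ?thesis by (rule bij_betw_same_card)
qed

lemma card_sol_Cons:
  assumes "2 * Suc (length xs) \<le> n"
  shows "card (sol c n (x # xs)) =
    (if x \<in> kspan xs then card (UNIV :: 'a set) else card (kspan (x # xs))) * card (sol c n xs)"
proof -
  define Y where "Y = (if x \<in> kspan xs then UNIV else kspan (x # xs))"
  have fibre: "card {ys. y # ys \<in> sol c n (x # xs)} = card (sol c n xs)" if "y \<in> Y" for y
  proof (cases "x \<in> kspan xs")
    case True
    then show ?thesis using ex_wedge_kspan card_sol_fibre by metis
  next
    case False
    then have "y \<in> kspan (x # xs)"
      using that by (simp add: Y_def)
    then obtain a u where au: "a \<in> K" "u \<in> kspan xs" "y = a * x + u"
      by auto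
    \<comment> \<open>The multiple of \<open>x\<close> in \<open>y\<close> contributes nothing,
      which leaves x \<and> u = u \<and> (-x), with \<open>u\<close> in the span of
      \<open>xs\<close>.\<close>
    obtain zs where zs: "length zs = length xs"
        "\<And>j. wedge (\<sigma> ^^ j) xs zs = u * (\<sigma> ^^ j) (- x) - (\<sigma> ^^ j) u * (- x)"
      using ex_wedge_kspan[OF au(2)] by blast
    have lin: "klinear (\<sigma> ^^ j)" for j by (rule klinear_funpow)
    have "(\<sigma> ^^ j) (- x) = - (\<sigma> ^^ j) x" for j
      using klinear_diff[OF lin, of j 0 x] klinear_zero[OF lin] by simp
    moreover have "(\<sigma> ^^ j) y = a * (\<sigma> ^^ j) x + (\<sigma> ^^ j) u" for j
      using au lin[of j] by (simp add: klinear_def)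
    ultimately have "wedge (\<sigma> ^^ j) xs zs = x * (\<sigma> ^^ j) y - (\<sigma> ^^ j) x * y" for j
      using zs(2)[of j] au(3) by (simp add: algebra_simps)
    then show ?thesis using zs(1) by (intro card_sol_fibre[of zs]) auto
  qed
  have "y \<in> Y" if "y # ys \<in> sol c n (x # xs)" for y ys
    using head_in_kspan[OF that assms] by (auto simp: Y_def)
  then have "sol c n (x # xs) = (\<lambda>(y, ys). y # ys) ` (SIGMA y:Y. {ys. y # ys \<in> sol c n (x # xs)})"
    by (auto simp: sol_def length_Suc_conv image_iff)
  moreover have "inj_on (\<lambda>(y, ys). y # ys) (SIGMA y:Y. {ys. y # ys \<in> sol c n (x # xs)})"
    by (auto intro: inj_onI)
  ultimately have "card (sol c n (x # xs)) = card (SIGMA y:Y. {ys. y # ys \<in> sol c n (x # xs)})"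
    using card_image by metis
  also have "finite {ys. y # ys \<in> sol c n (x # xs)}" for y
    by (rule finite_subset[OF _ finite_lists[of "length xs"]]) (auto simp: sol_def)
  then have "card (SIGMA y:Y. {ys. y # ys \<in> sol c n (x # xs)}) =
      (\<Sum>y\<in>Y. card {ys. y # ys \<in> sol c n (x # xs)})"
    by (intro card_SigmaI) auto
  also have "\<dots> = card Y * card (sol c n xs)"
    using fibre by simp
  finally show ?thesis by (simp add: Y_def)
qed

text \<open>Generalised over the entries \<open>xs\<close> already chosen, so that the induction can
  follow their span; \<open>D\<close> is its codimension over \<open>K\<close>.\<close>

lemma sum_card_sol_append:
  assumes "2 * (i + length xs) \<le> n" "card K ^ D * card (kspan xs) = card (UNIV :: 'a set)"
  shows "(\<Sum>zs | length zs = i. real (card (sol c n (zs @ xs)))) =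
    real (card (sol c n xs)) * real (card (UNIV :: 'a set)) ^ i * real (card (kspan xs)) ^ i * rad_moment (card K) D i"
  using assms
proof (induction i arbitrary: xs D)
  case 0
  then show ?case by simp
next
  case (Suc i)
  define q u F S where "q = real (card K)" and "u = real (card (kspan xs))"
    and "F = real (card (UNIV :: 'a set))" and "S = real (card (sol c n xs))"
  define R where "R = (\<lambda>z. \<Sum>zs | length zs = i. real (card (sol c n (zs @ z # xs))))"
  have "card K > 0" "card (kspan xs) > 0"
    using ksubspaceD(1)[OF ksubspace_kspan] by (auto simp: card_gt_0_iff)
  then have pos: "q > 0" "u > 0" and F: "F = q ^ D * u"
    using Suc.prems(2) by (auto simp: q_def u_def F_def simp flip: of_nat_power of_nat_mult)
  \<comment> \<open>The last entry is split off because it stands next to \<open>xs\<close>: the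
    induction hypothesis then applies to \<open>z # xs\<close>.\<close>
  have "{zs :: 'a list. length zs = Suc i} = (\<lambda>(z, zs). zs @ [z]) ` (UNIV \<times> {zs. length zs = i})"
    by (auto simp: length_Suc_conv_rev image_iff)
  moreover have "inj_on (\<lambda>(z, zs :: 'a list). zs @ [z]) (UNIV \<times> {zs. length zs = i})"
    by (auto intro: inj_onI)
  ultimately have "(\<Sum>zs | length zs = Suc i. real (card (sol c n (zs @ xs)))) = (\<Sum>z\<in>UNIV. R z)"
    by (simp add: sum.reindex R_def sum.cartesian_product case_prod_unfold o_def)
  also have "\<dots> = (\<Sum>z\<in>kspan xs. R z) + (\<Sum>z\<in>- kspan xs. R z)"
    using sum.subset_diff[of "kspan xs" UNIV R] by (simp add: Compl_eq_Diff_UNIV add.commute)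
  also have "(\<Sum>z\<in>kspan xs. R z) = (\<Sum>z\<in>kspan xs. S * F * F ^ i * u ^ i * rad_moment q D i)"
  proof (intro sum.cong refl)
    fix z assume z: "z \<in> kspan xs"
    then have "R z = real (card (sol c n (z # xs))) * F ^ i * u ^ i * rad_moment q D i"
      using Suc.IH[of "z # xs" D] Suc.prems kspan_Cons_absorb[OF z]
      by (simp add: R_def F_def u_def q_def del: kspan.simps)
    then show "R z = S * F * F ^ i * u ^ i * rad_moment q D i"
      using z card_sol_Cons[of xs n c z] Suc.prems by (simp add: S_def F_def)
  qed
  also have "(\<Sum>z\<in>- kspan xs. R z) =
      (\<Sum>z\<in>- kspan xs. S * (q * u) * F ^ i * (q * u) ^ i * rad_moment q (D - 1) i)"
  proof (intro sum.cong refl)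
    fix z assume "z \<in> - kspan xs"
    then have z: "z \<notin> kspan xs" by simp
    have card: "card (kspan (z # xs)) = card K * card (kspan xs)"
      by (rule card_kspan_Cons[OF z])
    \<comment> \<open>A vector outside the span exists only in positive codimension, so
      \<open>D - 1\<close> is not truncated below.\<close>
    have "D \<noteq> 0"
    proof
      assume "D = 0"
      then have "kspan xs = UNIV"
        using Suc.prems(2) by (intro card_subset_eq) auto
      then show False using z by simp
    qed
    then have "card K ^ (D - 1) * card (kspan (z # xs)) = card (UNIV :: 'a set)"
      using Suc.prems(2) unfolding card by (cases D) (auto simp: mult_ac)
    then have "R z = real (card (sol c n (z # xs))) * F ^ i * (q * u) ^ i * rad_moment q (D - 1) i"
      using Suc.IH[of "z # xs" "D - 1"] Suc.prems card
      by (simp add: R_def F_def u_def q_def del: kspan.simps)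
    then show "R z = S * (q * u) * F ^ i * (q * u) ^ i * rad_moment q (D - 1) i"
      using z card_sol_Cons[of xs n c z] Suc.prems card
      by (simp add: S_def u_def q_def del: kspan.simps)
  qed
  also have "real (card (- kspan xs)) = F - u"
    by (simp add: Compl_eq_Diff_UNIV card_Diff_subset F_def u_def card_mono of_nat_diff)
  then have "(\<Sum>z\<in>kspan xs. S * F * F ^ i * u ^ i * rad_moment q D i) +
      (\<Sum>z\<in>- kspan xs. S * (q * u) * F ^ i * (q * u) ^ i * rad_moment q (D - 1) i) =
      u * (S * F * F ^ i * u ^ i * rad_moment q D i) +
      (F - u) * (S * (q * u) * F ^ i * (q * u) ^ i * rad_moment q (D - 1) i)"
    by (simp add: u_def)
  also have "\<dots> = S * F ^ Suc i * u ^ Suc i * rad_moment q D (Suc i)"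
  proof -
    have "F - u = F * (1 - 1 / q ^ D)"
      using pos F by (simp add: field_simps)
    then show ?thesis
      by (simp only: rad_moment.simps power_Suc power_mult_distrib distrib_left mult_ac)
  qed
  finally show ?case by (simp add: S_def F_def u_def q_def)
qed

lemma sum_card_sol:
  assumes "2 * i \<le> n" "card K ^ D = card (UNIV :: 'a set)"
  shows "(\<Sum>zs | length zs = i. real (card (sol c n zs))) =
    real (card (UNIV :: 'a set)) ^ i * rad_moment (card K) D i"
proof -
  have "sol c n [] = {[]}" by (auto simp: sol_def)
  then show ?thesis using sum_card_sol_append[of i "[]" n D c] assms by simp
qed

end

section \<open>Gaussian binomials and the alternating sum\<close>

text \<open>Expresses a moment in dimension \<open>Suc D\<close> through dimension \<open>D\<close>
  alone, whereas the defining recursion mixes two dimensions. The induction on \<open>i\<close> uses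
  the claim for \<open>D\<close> and for \<open>D - 1\<close>; at \<open>i = 0\<close> the truncated
  \<open>i - 1\<close> has coefficient 0.\<close>

lemma rad_moment_Suc_Suc:
  assumes "q > 0"
  shows "q ^ i * rad_moment q (Suc D) i =
    rad_moment q D i + (q ^ (2 * i) - 1) * rad_moment q D (i - 1)"
proof (induction i arbitrary: D)
  case (Suc i)
  show ?case
  proof (cases i)
    case 0
    have "1 + (1 - 1 / q ^ Suc D) * q = 1 + q - 1 / q ^ D"
      using assms by (simp add: left_diff_distrib)
    then show ?thesis
      using 0 by (simp add: algebra_simps power2_eq_square)
  next
    case (Suc j)
    define r y where "r = 1 / q ^ D" and "y = q ^ i"
    have ysq: "q ^ (2 * i) = y\<^sup>2"
      by (simp add: y_def mult.commute flip: power_mult)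
    have i1: "i - 1 = j" using \<open>i = Suc j\<close> by simp
    have IH1: "y * rad_moment q (Suc D) i = rad_moment q D i + (y\<^sup>2 - 1) * rad_moment q D j"
      using Suc.IH[of D] unfolding ysq y_def[symmetric] i1 .
    \<comment> \<open>The factor \<open>1 - r\<close> vanishes for \<open>D = 0\<close>, where there
      is no lower dimension to apply the hypothesis to.\<close>
    have IH2: "(1 - r) * (y * rad_moment q D i) =
        (1 - r) * (rad_moment q (D - 1) i + (y\<^sup>2 - 1) * rad_moment q (D - 1) j)"
    proof (cases D)
      case (Suc E)
      then have D: "Suc (D - 1) = D" by simp
      show ?thesis
        using Suc.IH[of "D - 1"] unfolding ysq y_def[symmetric] i1 D by (simp only:)
    qed (simp add: r_def)
    have B: "rad_moment q D i = rad_moment q D j + (1 - r) * y * rad_moment q (D - 1) j"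
      by (simp add: \<open>i = Suc j\<close> r_def y_def)
    have lhs: "rad_moment q (Suc D) (Suc i) = rad_moment q (Suc D) i + (1 - r / q) * (q * y) * rad_moment q D i"
      unfolding rad_moment.simps r_def y_def using assms by simp
    have rhs: "rad_moment q D (Suc i) = rad_moment q D i + (1 - r) * (q * y) * rad_moment q (D - 1) i"
      unfolding rad_moment.simps r_def y_def by simp
    have powers: "q ^ Suc i = q * y" "q ^ (2 * Suc i) = (q * y)\<^sup>2"
      by (simp_all add: y_def power_mult_distrib power2_eq_square power_add mult_2)
    have frac: "(1 - r / q) * (q * y) = (q - r) * y"
      using assms by (simp add: left_diff_distrib)
    \<comment> \<open>A certificate: the desired difference is a combination of three differences
      that vanish by \<open>IH1\<close>, \<open>IH2\<close> and \<open>B\<close>. The letters stand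
      for the moments that occur.\<close>
    have comb: "q * y * (a + (1 - r / q) * (q * y) * b) - (b + (1 - r) * (q * y) * e + ((q * y)\<^sup>2 - 1) * b) =
        q * (y * a - (b + (y\<^sup>2 - 1) * c)) +
        q * y * ((1 - r) * (y * b) - (1 - r) * (e + (y\<^sup>2 - 1) * g)) -
        q * (y\<^sup>2 - 1) * (b - (c + (1 - r) * y * g))" for a b c e g
      unfolding frac by (simp add: algebra_simps power2_eq_square)
    have "q ^ Suc i * rad_moment q (Suc D) (Suc i) -
        (rad_moment q D (Suc i) + (q ^ (2 * Suc i) - 1) * rad_moment q D i) = 0"
      unfolding lhs rhs powers comb[where c = "rad_moment q D j" and g = "rad_moment q (D - 1) j"] IH1 IH2
      using B by simp
    then show ?thesis by simp
  qed
qed simp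

section \<open>Gaussian binomials and q-differences\<close>

lemma gauss_binom_0 [simp]: "gauss_binom q v 0 = 1"
  by (simp add: gauss_binom_def)

lemma Suc_choose_2: "Suc k choose 2 = (k choose 2) + k"
  by (simp add: numeral_2_eq_2)

lemma gauss_binom_Suc_right:
  assumes "q > 1"
  shows "(q ^ Suc i - 1) * gauss_binom q v (Suc i) = (q ^ (v - i) - 1) * gauss_binom q v i"
proof -
  have "q ^ Suc i \<noteq> 1" using assms by (metis less_irrefl one_less_power zero_less_Suc)
  then show ?thesis by (auto simp: gauss_binom_def not_le less_Suc_eq_le)
qed

lemma gauss_binom_Suc_Suc_mult:
  assumes "q > 1"
  shows "(q ^ Suc i - 1) * gauss_binom q (Suc v) (Suc i) = (q ^ Suc v - 1) * gauss_binom q v i"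
proof -
  have nz: "q ^ Suc k \<noteq> 1" for k using assms by (metis less_irrefl one_less_power zero_less_Suc)
  have "(\<Prod>k<Suc i. (q ^ (Suc v - k) - 1)) = (q ^ Suc v - 1) * (\<Prod>k<i. (q ^ (v - k) - 1))"
    by (simp add: prod.lessThan_Suc_shift del: prod.lessThan_Suc)
  then show ?thesis
    using nz[of i] by (simp add: gauss_binom_def prod_dividef)
qed

text \<open>The q-Pascal rule, from splitting \<open>q ^ Suc v - 1\<close> as
  \<open>(q ^ (v - i) - 1) + (q ^ Suc i - 1) * q ^ (v - i)\<close> and cancelling
  \<open>q ^ Suc i - 1\<close>.\<close>

lemma gauss_binom_Suc_Suc:
  assumes "q > 1"
  shows "gauss_binom q (Suc v) (Suc i) = gauss_binom q v (Suc i) + q ^ (v - i) * gauss_binom q v i"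
proof (cases "i \<le> v")
  case True
  have nz: "q ^ Suc i - 1 \<noteq> 0" using assms by (metis less_irrefl one_less_power zero_less_Suc right_minus_eq)
  have "q ^ Suc v = q ^ Suc i * q ^ (v - i)"
    using True by (simp flip: power_add)
  then have "(q ^ Suc v - 1) * gauss_binom q v i =
      (q ^ (v - i) - 1) * gauss_binom q v i + (q ^ Suc i - 1) * (q ^ (v - i) * gauss_binom q v i)"
    by (simp only: left_diff_distrib)
  then have "(q ^ Suc i - 1) * gauss_binom q (Suc v) (Suc i) =
      (q ^ Suc i - 1) * (gauss_binom q v (Suc i) + q ^ (v - i) * gauss_binom q v i)"
    using gauss_binom_Suc_Suc_mult[OF assms, of i v] gauss_binom_Suc_right[OF assms, of i v]
    by (simp only: distrib_left)
  then show ?thesis using nz by simp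
qed (simp add: gauss_binom_def)

text \<open>For q > 1 the q-binomial theorem makes this the product of the operators E - q^j for j <
  v, with E the index shift, applied to \<open>p\<close> and evaluated at 0.\<close>

definition q_diff :: "real \<Rightarrow> nat \<Rightarrow> (nat \<Rightarrow> real) \<Rightarrow> real" where
  "q_diff q v p = (\<Sum>i\<le>v. (-1) ^ (v - i) * q ^ ((v - i) choose 2) * gauss_binom q v i * p i)"

text \<open>Splits the factor E - 1 off the operator product; the remaining factors E - q^j with 1
  \<le> j \<le> v account for the extra \<open>q ^ (v - i)\<close>.\<close>

lemma q_diff_Suc:
  assumes "q > 1"
  shows "q_diff q (Suc v) p = (\<Sum>i\<le>v. (-1) ^ (v - i) * q ^ ((v - i) choose 2) * q ^ (v - i) *
    gauss_binom q v i * (p (Suc i) - p i))"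
proof -
  define c where "c v i = (-1) ^ (v - i) * q ^ ((v - i) choose 2)" for v i :: nat
  have top: "gauss_binom q v (Suc v) = 0" by (simp add: gauss_binom_def)
  have "q_diff q (Suc v) p = c (Suc v) 0 * p 0 + (\<Sum>i\<le>v. c v i * gauss_binom q (Suc v) (Suc i) * p (Suc i))"
    by (simp add: q_diff_def sum.atMost_Suc_shift c_def del: sum.atMost_Suc)
  also have "\<dots> = (c (Suc v) 0 * p 0 + (\<Sum>i\<le>v. c v i * gauss_binom q v (Suc i) * p (Suc i))) +
      (\<Sum>i\<le>v. c v i * q ^ (v - i) * gauss_binom q v i * p (Suc i))"
    by (simp add: gauss_binom_Suc_Suc[OF assms] distrib_left distrib_right sum.distrib mult_ac)
  also have "c (Suc v) 0 * p 0 + (\<Sum>i\<le>v. c v i * gauss_binom q v (Suc i) * p (Suc i)) =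
      (\<Sum>i\<le>Suc v. c (Suc v) i * gauss_binom q v i * p i)"
    by (simp add: sum.atMost_Suc_shift c_def del: sum.atMost_Suc)
  also have "\<dots> = (\<Sum>i\<le>v. c (Suc v) i * gauss_binom q v i * p i)"
    by (simp add: top)
  also have "\<dots> = - (\<Sum>i\<le>v. c v i * q ^ (v - i) * gauss_binom q v i * p i)"
    unfolding sum_negf[symmetric]
  proof (intro sum.cong refl)
    fix i assume "i \<in> {..v}"
    then obtain k where "v - i = k" "Suc v - i = Suc k"
      by (metis Suc_diff_le atMost_iff)
    then show "c (Suc v) i * gauss_binom q v i * p i = - (c v i * q ^ (v - i) * gauss_binom q v i * p i)"
      by (simp add: c_def Suc_choose_2 power_add)
  qed
  finally show ?thesis
    unfolding c_def by (simp add: right_diff_distrib sum_subtractf)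
qed

text \<open>Shifting the index in the \<open>p (i - 1)\<close> part gives \<open>p i\<close> the
  weight \<open>- (q ^ (v - i) - 1)\<close>, which reduces the weight \<open>q ^ (v - i)\<close> to
  1. The factor \<open>q ^ i - 1\<close> removes the truncated index at
  \<open>i = 0\<close>.\<close>

lemma q_diff_collapse:
  assumes "q > 1"
  shows "(\<Sum>i\<le>v. (-1) ^ (v - i) * q ^ ((v - i) choose 2) * q ^ (v - i) * gauss_binom q v i *
    (p i + (q ^ i - 1) * p (i - 1))) = q_diff q v p"
proof -
  define c where "c i = (-1) ^ (v - i) * q ^ ((v - i) choose 2)" for i :: nat
  have "(\<Sum>i\<le>v. c i * q ^ (v - i) * gauss_binom q v i * ((q ^ i - 1) * p (i - 1))) =
      (\<Sum>i<v. c (Suc i) * q ^ (v - Suc i) * ((q ^ Suc i - 1) * gauss_binom q v (Suc i)) * p i)"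
    by (simp add: sum.atMost_shift mult_ac)
  also have "\<dots> = (\<Sum>i<v. - c i * ((q ^ (v - i) - 1) * gauss_binom q v i) * p i)"
    unfolding gauss_binom_Suc_right[OF assms]
  proof (intro sum.cong refl)
    fix i assume "i \<in> {..<v}"
    then obtain k where "v - i = Suc k" "v - Suc i = k"
      by (metis Suc_diff_Suc lessThan_iff)
    then show "c (Suc i) * q ^ (v - Suc i) * ((q ^ (v - i) - 1) * gauss_binom q v i) * p i =
        - c i * ((q ^ (v - i) - 1) * gauss_binom q v i) * p i"
      by (simp add: c_def Suc_choose_2 power_add)
  qed
  also have "\<dots> = (\<Sum>i\<le>v. - c i * ((q ^ (v - i) - 1) * gauss_binom q v i) * p i)"
    by (simp flip: lessThan_Suc_atMost)
  finally have shifted: "(\<Sum>i\<le>v. c i * q ^ (v - i) * gauss_binom q v i * ((q ^ i - 1) * p (i - 1))) = \<dots>" .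
  have "(\<Sum>i\<le>v. c i * q ^ (v - i) * gauss_binom q v i * (p i + (q ^ i - 1) * p (i - 1))) =
      (\<Sum>i\<le>v. c i * q ^ (v - i) * gauss_binom q v i * p i + - c i * ((q ^ (v - i) - 1) * gauss_binom q v i) * p i)"
    unfolding distrib_left sum.distrib shifted ..
  also have "\<dots> = (\<Sum>i\<le>v. c i * gauss_binom q v i * p i)"
    by (intro sum.cong refl) (simp add: left_diff_distrib right_diff_distrib)
  finally show ?thesis
    by (simp only: c_def q_diff_def)
qed

text \<open>For h > 0, the difference of consecutive moments in dimension \<open>2 * h\<close> is a
  constant times \<open>q ^ i\<close> times a moment in dimension \<open>2 * h - 1\<close>. The
  recursion in the dimension rewrites this through \<open>2 * h - 2\<close> in the form that
  collapses for base \<open>q\<^sup>2\<close>.\<close>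

lemma q_diff_rad_moment:
  assumes "q > 1"
  shows "q_diff (q\<^sup>2) v (rad_moment q (2 * h)) = (\<Prod>j<v. q * (1 - q ^ (2 * j) / q ^ (2 * h)))"
proof (induction v arbitrary: h)
  case 0
  then show ?case by (simp add: q_diff_def binomial_eq_0)
next
  case (Suc v)
  have q2: "q\<^sup>2 > 1" using assms by simp
  show ?case
  proof (cases h)
    \<comment> \<open>In dimension 0 all moments are 1, so the differences vanish, as does the
      factor for \<open>j = 0\<close> on the right.\<close>
    case 0
    then show ?thesis
      by (simp add: q_diff_Suc[OF q2] prod.lessThan_Suc_shift del: prod.lessThan_Suc)
  next
    case (Suc g)
    have step: "rad_moment q (2 * h) (Suc i) - rad_moment q (2 * h) i = q * (1 - 1 / q ^ (2 * h)) *
        (rad_moment q (2 * g) i + ((q\<^sup>2) ^ i - 1) * rad_moment q (2 * g) (i - 1))" for i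
    proof -
      have "q ^ i * rad_moment q (Suc (2 * g)) i =
          rad_moment q (2 * g) i + ((q\<^sup>2) ^ i - 1) * rad_moment q (2 * g) (i - 1)"
        using rad_moment_Suc_Suc[of q i "2 * g"] assms by (simp only: power_mult)
      moreover have "rad_moment q (2 * h) (Suc i) - rad_moment q (2 * h) i =
          q * (1 - 1 / q ^ (2 * h)) * (q ^ i * rad_moment q (Suc (2 * g)) i)"
        using Suc by simp
      ultimately show ?thesis by simp
    qed
    have "q_diff (q\<^sup>2) (Suc v) (rad_moment q (2 * h)) =
        q * (1 - 1 / q ^ (2 * h)) * q_diff (q\<^sup>2) v (rad_moment q (2 * g))"
      unfolding q_diff_Suc[OF q2] step unfolding q_diff_collapse[OF q2, symmetric]
      by (simp only: sum_distrib_left mult_ac)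
    also have "q_diff (q\<^sup>2) v (rad_moment q (2 * g)) = (\<Prod>j<v. q * (1 - q ^ (2 * Suc j) / q ^ (2 * h)))"
      unfolding Suc.IH using assms Suc by simp
    finally show ?thesis
      by (simp add: prod.lessThan_Suc_shift del: prod.lessThan_Suc)
  qed
qed

section \<open>The binary field\<close>

text \<open>Even positions carry the first components and odd positions the second, as in
  \<open>V_set\<close>; splitting and interleaving are mutually inverse.\<close>

lemma card_interleaved_lists:
  fixes P :: "'a::finite list \<Rightarrow> 'a list \<Rightarrow> bool"
  shows "card {L. length L = 2 * i \<and> P (map (\<lambda>l. L ! (2 * l)) [0..<i]) (map (\<lambda>l. L ! (2 * l + 1)) [0..<i])} =
    (\<Sum>xs | length xs = i. card {ys. length ys = i \<and> P xs ys})"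
proof -
  let ?split = "\<lambda>L. (map (\<lambda>l. L ! (2 * l)) [0..<i], map (\<lambda>l. L ! (2 * l + 1)) [0..<i])"
  let ?join = "\<lambda>(xs, ys). map (\<lambda>k. if even k then xs ! (k div 2) else ys ! (k div 2)) [0..<2 * i]"
  let ?S = "SIGMA xs:{xs :: 'a list. length xs = i}. {ys. length ys = i \<and> P xs ys}"
  have split_join: "?split (?join (xs, ys)) = (xs, ys)" if "length xs = i" "length ys = i" for xs ys :: "'a list"
    using that by (auto intro!: nth_equalityI)
  have join_split: "?join (?split L) = L" if "length L = 2 * i" for L :: "'a list"
    using that by (auto intro!: nth_equalityI)
  have "bij_betw ?split {L. length L = 2 * i \<and> P (map (\<lambda>l. L ! (2 * l)) [0..<i]) (map (\<lambda>l. L ! (2 * l + 1)) [0..<i])} ?S"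
  proof (rule bij_betw_byWitness[where f' = ?join])
    show "?join ` ?S \<subseteq> {L. length L = 2 * i \<and> P (map (\<lambda>l. L ! (2 * l)) [0..<i]) (map (\<lambda>l. L ! (2 * l + 1)) [0..<i])}"
      using split_join by fastforce
  qed (use join_split split_join in auto)
  moreover have "finite {xs :: 'a list. length xs = i}"
    using finite_lists_length_eq[of "UNIV :: 'a set" i] by simp
  ultimately show ?thesis
    by (simp add: bij_betw_same_card card_SigmaI)
qed

section \<open>Fixed points of power maps on a finite field\<close>

lemma power_card_eq_same:
  fixes x :: "'a::{field,finite}"
  shows "x ^ card (UNIV :: 'a set) = x"
proof (cases "x = 0")
  case False
  \<comment> \<open>Multiplication by the nonzero \<open>x\<close> permutes the nonzero elements and
    so preserves their product.\<close>
  have "(\<Prod>y\<in>UNIV - {0}. y) = (\<Prod>y\<in>UNIV - {0}. x * y)"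
    using False by (intro prod.reindex_bij_witness[of _ "\<lambda>y. x * y" "\<lambda>y. y / x"]) auto
  also have "\<dots> = x ^ (card (UNIV :: 'a set) - 1) * (\<Prod>y\<in>UNIV - {0}. y)"
    by (simp add: prod.distrib)
  finally have "x ^ (card (UNIV :: 'a set) - 1) = 1"
    by (simp add: prod_zero_iff)
  then show ?thesis
    by (metis Suc_diff_1 finite_UNIV_card_ge_0 finite_class.finite_UNIV mult.right_neutral power_Suc)
qed (simp add: card_gt_0_iff)

lemma power_minus_1_dvd: "\<exists>N. Suc p ^ k = p * N + 1" for p k :: nat
proof (induction k)
  case (Suc k)
  then obtain N where N: "Suc p ^ k = p * N + 1" by blast
  have "Suc p ^ Suc k = p * (Suc p * N + 1) + 1"
    unfolding power_Suc N by (simp add: algebra_simps)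
  then show ?case by blast
qed auto

text \<open>The upper bound counts roots of X^q - X. For the lower bound, X^(q^k) - X vanishes on
  the whole field and is X^q - X times a polynomial \<open>R\<close> of degree at most q^k - q,
  which leaves at least q fixed points.\<close>

lemma card_power_fixed_points:
  fixes q k :: nat
  assumes "card (UNIV :: 'a::{field,finite} set) = q ^ k" "q > 1"
  shows "card {a :: 'a. a ^ q = a} = q"
proof (rule antisym)
  define P :: "'a poly" where "P = monom 1 q - monom 1 1"
  have "coeff P q = 1" using assms(2) by (simp add: P_def)
  then have "P \<noteq> 0" by auto
  then have "card {a. poly P a = 0} \<le> degree P" by (rule card_poly_roots_bound)
  also have "degree P \<le> q"
    unfolding P_def using assms(2) by (intro degree_diff_le) (auto simp: degree_monom_eq)
  finally show "card {a :: 'a. a ^ q = a} \<le> q"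
    by (simp add: P_def poly_monom)
next
  obtain p where p: "q = Suc p" "p > 0" using assms(2) by (cases q) auto
  obtain N where N: "q ^ k = p * N + 1" using power_minus_1_dvd p by blast
  define R :: "'a poly" where "R = (\<Sum>i<N. monom 1 (p * i))"
  have "card {0, 1 :: 'a} \<le> card (UNIV :: 'a set)" by (rule card_mono) auto
  then have "k > 0" using assms(1) by (cases k) auto
  then have "q ^ k > 1" using assms(2) by (metis one_less_power)
  then have "N > 0" using N by (cases N) auto
  have "coeff R 0 = (\<Sum>i<N. if i = 0 then 1 else 0)"
    unfolding R_def coeff_sum using p by (intro sum.cong) auto
  also have "\<dots> = 1" using \<open>N > 0\<close> by simp
  finally have "R \<noteq> 0" by auto
  then have "card {a. poly R a = 0} \<le> degree R" by (rule card_poly_roots_bound)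
  also have "degree R \<le> p * (N - 1)"
    unfolding R_def by (intro degree_sum_le) (auto simp: degree_monom_eq)
  finally have R: "card {a. poly R a = 0} \<le> p * (N - 1)" .
  have "UNIV \<subseteq> {a :: 'a. a ^ q = a} \<union> {a. poly R a = 0}"
  proof clarify
    fix a :: 'a assume "poly R a \<noteq> 0"
    have "(a ^ p - 1) * poly R a * a = (a ^ (p * N) - 1) * a"
      by (simp add: R_def poly_sum poly_monom power_mult power_diff_1_eq)
    also have "\<dots> = a ^ (q ^ k) - a"
      by (simp add: N algebra_simps)
    also have "\<dots> = 0"
      using power_card_eq_same[of a] assms(1) by simp
    finally show "a ^ q = a"
      using \<open>poly R a \<noteq> 0\<close> p by (auto simp: algebra_simps)
  qed
  then have "card (UNIV :: 'a set) \<le> card ({a :: 'a. a ^ q = a} \<union> {a. poly R a = 0})"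
    by (intro card_mono) auto
  also have "\<dots> \<le> card {a :: 'a. a ^ q = a} + card {a. poly R a = 0}"
    by (rule card_Un_le)
  finally have "p * N + 1 \<le> card {a :: 'a. a ^ q = a} + p * (N - 1)"
    using R assms(1) N by linarith
  moreover have "p * N = p * (N - 1) + p"
    using \<open>N > 0\<close> by (cases N) auto
  ultimately show "q \<le> card {a :: 'a. a ^ q = a}"
    using p by linarith
qed

section \<open>Frobenius powers and the given system\<close>

locale binary_field =
  fixes m d :: nat and ty :: "'a::{field,finite} itself"
  assumes char: "CHAR('a) = 2" and card_field: "card (UNIV :: 'a set) = 2 ^ m"
begin

lemma power_mult_m: "(x :: 'a) ^ (2 ^ (m * k)) = x"
proof (induction k)
  case (Suc k)
  have "x ^ (2 ^ (m * Suc k)) = (x ^ (2 ^ (m * k))) ^ (2 ^ m)"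
    by (simp add: power_add mult.commute flip: power_mult)
  then show ?case using Suc power_card_eq_same[of x] card_field by simp
qed simp

text \<open>The m-th power of Frobenius is the identity, so the reduction modulo m in
  \<open>frob_exp\<close> is harmless.\<close>

lemma power_mod_m: "(x :: 'a) ^ (2 ^ (t mod m)) = x ^ (2 ^ t)"
proof -
  have "x ^ (2 ^ t) = x ^ (2 ^ (m * (t div m) + t mod m))" by simp
  also have "\<dots> = (x ^ (2 ^ (m * (t div m)))) ^ (2 ^ (t mod m))"
    by (simp only: power_add power_mult)
  finally show ?thesis by (simp add: power_mult_m)
qed

sublocale finite_field_endo "\<lambda>x :: 'a. x ^ (2 ^ d)"
proof
  fix x y :: 'a
  show "(x + y) ^ (2 ^ d) = x ^ (2 ^ d) + y ^ (2 ^ d)"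
    by (rule freshmans_dream'[of _ d]) (simp_all add: char)
qed (simp_all add: power_mult_distrib)

lemma funpow_frob: "((\<lambda>x :: 'a. x ^ (2 ^ d)) ^^ k) = (\<lambda>x. x ^ (2 ^ (d * k)))"
  by (induction k) (auto simp: fun_eq_iff power_add mult.commute simp flip: power_mult)

text \<open>By Bezout, and because the m-th Frobenius power is the identity, the d-th power has the
  same fixed points as the one with exponent \<open>gcd m d\<close>.\<close>

lemma card_K:
  assumes "d > 0" "m > 0"
  shows "card K = 2 ^ gcd m d"
proof -
  define e where "e = gcd m d"
  have "a ^ (2 ^ d) = a \<longleftrightarrow> a ^ (2 ^ e) = a" for a :: 'a
  proof
    assume a: "a ^ (2 ^ d) = a"
    obtain x y where xy: "d * x = m * y + e"
      using bezout_nat[of d m] assms by (auto simp: e_def gcd.commute)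
    have "((\<lambda>x. x ^ (2 ^ d)) ^^ x) a = a"
      using a by (induction x) auto
    then have "a = a ^ (2 ^ (m * y + e))"
      unfolding funpow_frob xy by simp
    also have "\<dots> = (a ^ (2 ^ (m * y))) ^ (2 ^ e)"
      by (simp only: power_add power_mult)
    finally show "a ^ (2 ^ e) = a" by (simp add: power_mult_m)
  next
    assume a: "a ^ (2 ^ e) = a"
    have "a ^ (2 ^ (e * k)) = a" for k
      by (induction k) (use a in \<open>auto simp: power_add mult.commute power_mult\<close>)
    then show "a ^ (2 ^ d) = a"
      by (metis dvd_def e_def gcd_dvd2)
  qed
  moreover have "card (UNIV :: 'a set) = (2 ^ e) ^ (m div e)"
    by (simp add: card_field e_def flip: power_mult)
  moreover have "e > 0" using assms by (simp add: e_def)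
  then have "(1 :: nat) < 2 ^ e" by (intro one_less_power) auto
  ultimately show ?thesis
    using card_power_fixed_points[where ?'a = 'a, of "2 ^ e" "m div e"]
    unfolding K_def e_def[symmetric] by simp
qed

text \<open>In characteristic 2 the plus sign of the system is the minus sign of
  \<open>wedge\<close>.\<close>

lemma V_set_conv:
  "(V_set m n d e s i :: 'a list set) = {L. length L = 2 * i \<and> (\<forall>j\<le>s.
    wedge (\<lambda>x. x ^ (2 ^ frob_exp m n d e j)) (map (\<lambda>l. L ! (2 * l)) [0..<i]) (map (\<lambda>l. L ! (2 * l + 1)) [0..<i]) = 0)}"
proof -
  have "wedge \<psi> (map (\<lambda>l. L ! (2 * l)) [0..<i]) (map (\<lambda>l. L ! (2 * l + 1)) [0..<i]) =
      (\<Sum>l<i. L ! (2 * l) * \<psi> (L ! (2 * l + 1)) + \<psi> (L ! (2 * l)) * L ! (2 * l + 1))"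
    for L :: "'a list" and \<psi>
    by (subst wedge_conv_sum[of _ i]) (auto simp: minus_CHAR_2[OF char] intro!: sum.cong)
  then show ?thesis unfolding V_set_def by simp
qed

text \<open>The equations for \<open>j \<le> s\<close> carry the exponents \<open>(n/e - j) d\<close>. Applying the inverse
  Frobenius power gives the same equations with \<open>(n/e + j) d\<close>, since \<open>(2n/e) d\<close> is a multiple of \<open>m\<close>.
  Adding \<open>m s\<close> to the start keeps the window of \<open>2s + 1\<close> powers of \<open>\<sigma>\<close> nonnegative.\<close>
lemma sol_conv:
  assumes "m = 2 * n" "e = gcd n d" "n > 0"
  shows "sol (n div e + m * s - s) (2 * s + 1) xs = {ys :: 'a list. length ys = length xs \<and>
    (\<forall>j\<le>s. wedge (\<lambda>x. x ^ (2 ^ frob_exp m n d e j)) xs ys = 0)}"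
proof -
  define c where "c = n div e + m * s - s"
  let ?\<sigma> = "\<lambda>x :: 'a. x ^ (2 ^ d)"
  have "s \<le> m * s" using assms by (cases m) auto
  then have c: "c + s = n div e + m * s" unfolding c_def by linarith
  have frob: "?\<sigma> ^^ (c + (s - j)) = (\<lambda>x. x ^ (2 ^ frob_exp m n d e j))" if "j \<le> s" for j
  proof -
    have "int (d * (c + (s - j))) = int d * (int (c + s) - int j)"
      using that by (simp add: of_nat_diff)
    also have "\<dots> = (int (n div e) - int j) * int d + int m * (int s * int d)"
      unfolding c by (simp add: algebra_simps)
    finally have "int (d * (c + (s - j)) mod m) = ((int (n div e) - int j) * int d) mod int m"
      by (simp add: zmod_int)
    then have "d * (c + (s - j)) mod m = frob_exp m n d e j"
      unfolding frob_exp_def by (metis nat_int)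
    then show ?thesis
      unfolding funpow_frob by (metis power_mod_m)
  qed
  \<comment> \<open>The two Frobenius exponents add up to \<open>2 * d * (n div e)\<close> plus a
    multiple of m, and the former equals \<open>m * (d div e)\<close> because m = 2n.\<close>
  have period: "(?\<sigma> ^^ (c + (s + j))) ((?\<sigma> ^^ (c + (s - j))) x) = x" if "j \<le> s" for j x
  proof -
    have "e dvd n" "e dvd d" using assms by auto
    have "(c + (s - j)) + (c + (s + j)) = 2 * (c + s)"
      using that by simp
    then have "(c + (s - j)) + (c + (s + j)) = 2 * (n div e + m * s)"
      unfolding c .
    moreover have "d * (2 * (n div e + m * s)) = m * (d div e + 2 * (d * s))"
    proof -
      have "d * (n div e) = n * (d div e)"
        using \<open>e dvd n\<close> \<open>e dvd d\<close> by (metis div_mult_swap mult.commute)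
      then show ?thesis
        unfolding assms(1) by (simp add: distrib_left mult_ac)
    qed
    ultimately have "d * (c + (s - j)) + d * (c + (s + j)) = m * (d div e + 2 * (d * s))"
      by (metis distrib_left)
    then show ?thesis
      unfolding funpow_frob by (simp flip: power_mult power_add add: power_mult_m)
  qed
  have "(\<forall>k<2 * s + 1. wedge (?\<sigma> ^^ (c + k)) xs ys = 0) \<longleftrightarrow>
      (\<forall>j\<le>s. wedge (?\<sigma> ^^ (c + (s - j))) xs ys = 0)" if len: "length ys = length xs" for ys
  proof
    assume *: "\<forall>j\<le>s. wedge (?\<sigma> ^^ (c + (s - j))) xs ys = 0"
    have "wedge (?\<sigma> ^^ (c + (s + j))) xs ys = 0" if "j \<le> s" for j
      using wedge_involution[OF len[symmetric] period[OF that]] * that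
      by (simp add: klinear_zero[OF klinear_funpow])
    then show "\<forall>k<2 * s + 1. wedge (?\<sigma> ^^ (c + k)) xs ys = 0"
    proof (intro allI impI)
      fix k assume "k < 2 * s + 1"
      show "wedge (?\<sigma> ^^ (c + k)) xs ys = 0"
      proof (cases "k \<le> s")
        case True
        then show ?thesis using *[rule_format, of "s - k"] by simp
      next
        case False
        then show ?thesis
          using \<open>\<And>j. j \<le> s \<Longrightarrow> wedge (?\<sigma> ^^ (c + (s + j))) xs ys = 0\<close>[of "k - s"] \<open>k < 2 * s + 1\<close>
          by simp
      qed
    qed
  next
    assume *: "\<forall>k<2 * s + 1. wedge (?\<sigma> ^^ (c + k)) xs ys = 0"
    have "s - j < 2 * s + 1" for j by simp
    from *[rule_format, OF this]
    show "\<forall>j\<le>s. wedge (?\<sigma> ^^ (c + (s - j))) xs ys = 0" by blast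
  qed
  then show ?thesis
    unfolding sol_def c_def[symmetric] using frob by auto
qed

text \<open>The window of 2s + 1 powers is long enough for \<open>i \<le> s\<close> pairs, and the
  field has dimension m/e = 2(n/e) over \<open>K\<close>.\<close>

lemma card_V_set:
  assumes "m = 2 * n" "e = gcd n d" "e = gcd m d" "n > 0" "d > 0" "i \<le> s"
  shows "real (card (V_set m n d e s i :: 'a list set)) =
    2 ^ (m * i) * rad_moment (2 ^ e) (2 * (n div e)) i"
proof -
  have "card (V_set m n d e s i :: 'a list set) = (\<Sum>xs | length xs = i.
      card {ys :: 'a list. length ys = i \<and> (\<forall>j\<le>s. wedge (\<lambda>x. x ^ (2 ^ frob_exp m n d e j)) xs ys = 0)})"
    unfolding V_set_conv by (rule card_interleaved_lists)
  also have "\<dots> = (\<Sum>xs | length xs = i. card (sol (n div e + m * s - s) (2 * s + 1) xs :: 'a list set))"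
    unfolding sol_conv[OF assms(1,2,4)] by simp
  finally have "real (card (V_set m n d e s i :: 'a list set)) =
      (\<Sum>xs | length xs = i. real (card (sol (n div e + m * s - s) (2 * s + 1) xs :: 'a list set)))"
    by simp
  also have "\<dots> = real (card (UNIV :: 'a set)) ^ i * rad_moment (real (card K)) (2 * (n div e)) i"
  proof (rule sum_card_sol)
    have "e dvd n" using assms by simp
    then show "card K ^ (2 * (n div e)) = card (UNIV :: 'a set)"
      using card_K assms card_field by (simp flip: power_mult assms(3))
  qed (use assms in simp)
  finally show ?thesis
    using card_K assms card_field by (simp add: power_mult flip: assms(3))
qed

end

theorem theorem7p2:
  fixes m n d e s v :: nat
  assumes "CHAR('a) = 2" and "card (UNIV :: 'a::{field,finite} set) = 2 ^ m"
    and "m > 0" "n > 0" "d > 0" "e > 0"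
    and "m = 2 * n" and "e = gcd n d" and "e = gcd m d"
    and "v \<ge> 1" and "s \<ge> v"
  shows "(\<Sum>i\<le>v. (-1) ^ (v - i) * 4 ^ (e * ((v - i) choose 2)) * gauss_binom (4 ^ e) v i
            * (2::real) powi (- int (m * i))
            * real (card (V_set m n d e s i :: 'a list set)))
         = (2::real) powi ((int e - int m) * int v) * (\<Prod>j<v. 2 ^ m - 4 ^ (e * j))"
proof -
  interpret binary_field m d "TYPE('a)"
    by standard (use assms in auto)
  define q :: real where "q = 2 ^ e"
  have "q > 1" using \<open>e > 0\<close> by (simp add: q_def)
  have q4: "q\<^sup>2 = 4 ^ e" by (simp add: q_def power2_eq_square flip: power_mult_distrib)
  have qm: "q ^ (2 * (n div e)) = 2 ^ m"
    using assms(7,8) by (simp add: q_def flip: power_mult)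
  have "(\<Sum>i\<le>v. (-1) ^ (v - i) * 4 ^ (e * ((v - i) choose 2)) * gauss_binom (4 ^ e) v i
      * (2::real) powi (- int (m * i)) * real (card (V_set m n d e s i :: 'a list set))) =
      q_diff (q\<^sup>2) v (rad_moment q (2 * (n div e)))"
    unfolding q_diff_def
  proof (intro sum.cong refl)
    fix i assume "i \<in> {..v}"
    then have "(2::real) powi (- int (m * i)) * real (card (V_set m n d e s i :: 'a list set)) =
        rad_moment q (2 * (n div e)) i"
      using card_V_set[OF assms(7-9) \<open>n > 0\<close> \<open>d > 0\<close>, of i s] \<open>s \<ge> v\<close>
      by (simp add: q_def power_int_minus power_int_of_nat flip: of_nat_mult)
    then show "(-1) ^ (v - i) * 4 ^ (e * ((v - i) choose 2)) * gauss_binom (4 ^ e) v i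
        * (2::real) powi (- int (m * i)) * real (card (V_set m n d e s i :: 'a list set)) =
        (-1) ^ (v - i) * (q\<^sup>2) ^ ((v - i) choose 2) * gauss_binom (q\<^sup>2) v i * rad_moment q (2 * (n div e)) i"
      unfolding q4 power_mult by (simp only: mult.assoc)
  qed
  also have "\<dots> = (\<Prod>j<v. q * (1 - q ^ (2 * j) / q ^ (2 * (n div e))))"
    by (rule q_diff_rad_moment[OF \<open>q > 1\<close>])
  \<comment> \<open>Clearing the denominator, which is 2^m, takes a constant
    \<open>q / 2 ^ m\<close> out of each factor; these give the power of 2 in front.\<close>
  also have "\<dots> = (\<Prod>j<v. (q / 2 ^ m) * (2 ^ m - 4 ^ (e * j)))"
  proof (intro prod.cong refl)
    fix j
    have "(4::real) ^ (e * j) = q ^ (2 * j)"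
      by (simp only: power_mult q4)
    then show "q * (1 - q ^ (2 * j) / q ^ (2 * (n div e))) = q / 2 ^ m * (2 ^ m - 4 ^ (e * j))"
      unfolding qm by (simp add: field_simps)
  qed
  also have "\<dots> = (q / 2 ^ m) ^ v * (\<Prod>j<v. 2 ^ m - 4 ^ (e * j))"
    unfolding prod.distrib by simp
  also have "q / 2 ^ m = 2 powi (int e - int m)"
    by (simp add: q_def power_int_diff)
  also have "(2 powi (int e - int m)) ^ v = (2::real) powi ((int e - int m) * int v)"
    by (simp add: power_int_mult)
  finally show ?thesis .
qed

end
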